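(* Consider the $T_{LNB}$ model with parameters $c_1,c_2,c_3>0$, $k>0$ such that $E_2$ has strictly positive coordinates. The bifurcation parameter surface of the period-doubling bifurcation at $E_2$ is $PD_{LNB}=0$. Furthermore, if a period-doubling bifurcation takes place at $E_2$, the following transversality condition should be satisfied: $$PT_{LNB}^k\neq0,\quad PT_{LNB}^{c_1}\neq0,\quad PT_{LNB}^{c_2}\neq0,\quad PT_{LNB}^{c_3}\neq0.$$ Here $$\begin{aligned}PD_{LNB}={}&(3c_1^3-11c_1^2c_2-5c_1^2c_3-15c_1c_2^2+54c_1c_2c_3-3c_1c_3^2-c_2^3+43c_2^2c_3-47c_2c_3^2+5c_3^3)k\\&-6c_1^2+20c_1c_2-4c_1c_3-38c_2^2-36c_2c_3+2c_3^2,\end{aligned}$$ $$PT_{LNB}^k=5c_3^2+(2c_1-42c_2)c_3-3c_1^2+14c_1c_2+c_2^2,$$ $$PT_{LNB}^{c_1}=(kc_3-c_1k-c_2k+4)(c_3+c_1-7c_2),$$ $$PT_{LNB}^{c_2}=5kc_3^2+(-8c_1k-6c_2k+2)c_3+3c_1^2k+4c_1c_2k+c_2^2k-6c_1+2c_2,$$ $$PT_{LNB}^{c_3}=c_3^2+(-2c_1-18c_2)c_3-3c_1^2+10c_1c_2-19c_2^2.$$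
   Context: The $T_{LNB}$ model is the 3-dimensional discrete dynamical system $$\begin{aligned}x(t+1)&=\tfrac12\left[2x(t)+y(t)+z(t)-c_1\big(x(t)+y(t)+z(t)\big)^2\right],\\ y(t+1)&=\sqrt{\tfrac{x(t)+z(t)}{c_2}}-x(t)-z(t),\\ z(t+1)&=z(t)+kz(t)\left[\tfrac{x(t)+y(t)}{(x(t)+y(t)+z(t))^2}-c_3\right],\end{aligned}$$ with equilibrium $$E_2=\left(\frac{2(c_2+c_3-c_1)}{(c_1+c_2+c_3)^2},\frac{2(c_1+c_3-c_2)}{(c_1+c_2+c_3)^2},\frac{2(c_1+c_2-c_3)}{(c_1+c_2+c_3)^2}\right).$$ Write $\boldsymbol u=(k,c_1,c_2,c_3)$ for the parameters and let $\lambda^3+a_2\lambda^2+a_1\lambda+a_0$, with $a_i=a_i(\boldsymbol u)$, be the characteristic polynomial of the Jacobian matrix of the iteration map at $E_2$. A period-doubling (flip) bifurcation takes place at a parameter point $\overline{\boldsymbol u}$ if and only if: (1) eigenvalue assignment: the Jacobian matrix at the equilibrium has one real eigenvalue $\lambda_1(\overline{\boldsymbol u})=-1$ and all other eigenvalues satisfy $|\lambda_j(\overline{\boldsymbol u})|<1$; (2) transversality: $\partial|\lambda_1(\boldsymbol u)|/\partial u_j\neq0$ at $\boldsymbol u=\overline{\boldsymbol u}$ for every parameter $u_j$. In terms of the coefficients, the criterion used is: $1+a_2+a_1+a_0>0$, $-1+a_2-a_1+a_0=0$, $-a_0^2-a_0a_2+a_1+1>0$, $-a_0^2+a_0a_2-a_1+1>0$,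 and $$\frac{\partial a_0/\partial u_j-\partial a_1/\partial u_j+\partial a_2/\partial u_j}{3-2a_2+a_1}\neq0\quad\text{for every parameter }u_j,$$ where $\partial a_i/\partial u_j$ is the partial derivative of $a_i(\boldsymbol u)$ with respect to $u_j$. The bifurcation parameter surface of the period-doubling bifurcation is the surface in parameter space determined by $-1+a_2-a_1+a_0=0$ at $E_2$.
   Formalization: The parameter derivatives in the transversality condition are taken with the state held fixed at E_2, not through E_2(u); with the latter the claim fails, e.g. at (k,c1,c2,c3)=(1,3,3,2), where a period doubling occurs but PT^{c1}=PT^{c2}=0. *)

theory Defs
  imports
    "HOL-Analysis.Analysis"
    "HOL-Computational_Algebra.Polynomial"
begin

section \<open>Characteristic polynomials and eigenvalues of real square matrices\<close>

definition charpoly :: "'a::comm_ring_1 ^ 'n ^ 'n \<Rightarrow> 'a poly" where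
  "charpoly A = det (mat [:0, 1:] - map_matrix (\<lambda>a. [:a:]) A)"

text \<open>The complex eigenvalues, repeated according to algebraic multiplicity.\<close>

definition eigvals :: "real ^ 'n ^ 'n \<Rightarrow> complex multiset" where
  "eigvals A = proots (map_poly complex_of_real (charpoly A))"


section \<open>Period-doubling bifurcations of parametrised maps\<close>

definition jac :: "(real ^ 'p \<Rightarrow> real ^ 'n \<Rightarrow> real ^ 'n) \<Rightarrow> real ^ 'p \<Rightarrow> real ^ 'n \<Rightarrow> real ^ 'n ^ 'n" where
  "jac F u x = jacobian (F u) (at x)"

definition flip_eigenvalue_assignment ::
    "(real ^ 'p \<Rightarrow> real ^ 'n \<Rightarrow> real ^ 'n) \<Rightarrow> real ^ 'p \<Rightarrow> real ^ 'n \<Rightarrow> bool" where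
  "flip_eigenvalue_assignment F u x \<longleftrightarrow>
     -1 \<in># eigvals (jac F u x) \<and>
     (\<forall>\<mu> \<in># eigvals (jac F u x) - {#-1#}. cmod \<mu> < 1)"

text \<open>
  Here \<open>lam\<close> is the branch of the critical eigenvalue, as a function \<open>\<lambda>\<^sub>1\<close> of the parameters
  near \<open>u\<close>. If -1 is a simple eigenvalue at \<open>u\<close>, continuity at \<open>u\<close> determines this branch uniquely
  near \<open>u\<close>. The Jacobian is regarded as a function of state and parameters, and the partial
  derivative with respect to the \<open>j\<close>-th parameter is taken with all other arguments, including the
  state \<open>x\<close>, held fixed: the equilibrium is inserted for \<open>x\<close>, and the dependence of the equilibrium
  itself on the parameters is not differentiated.
\<close>

definition flip_transversality ::
    "(real ^ 'p \<Rightarrow> real ^ 'n \<Rightarrow> real ^ 'n) \<Rightarrow> real ^ 'p \<Rightarrow> real ^ 'n \<Rightarrow> bool" where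
  "flip_transversality F u x \<longleftrightarrow>
     (\<exists>lam :: real ^ 'p \<Rightarrow> real.
        isCont lam u \<and> lam u = -1 \<and>
        (\<forall>\<^sub>F v in nhds u. complex_of_real (lam v) \<in># eigvals (jac F v x)) \<and>
        (\<forall>j. \<exists>D. ((\<lambda>h. \<bar>lam (u + h *\<^sub>R axis j 1)\<bar>) has_real_derivative D) (at 0) \<and> D \<noteq> 0))"

definition flip_bifurcation ::
    "(real ^ 'p \<Rightarrow> real ^ 'n \<Rightarrow> real ^ 'n) \<Rightarrow> real ^ 'p \<Rightarrow> real ^ 'n \<Rightarrow> bool" where
  "flip_bifurcation F u x \<longleftrightarrow> flip_eigenvalue_assignment F u x \<and> flip_transversality F u x"


section \<open>The model\<close>

text \<open>Parameter vectors are ordered as \<open>u = (k, c\<^sub>1, c\<^sub>2, c\<^sub>3)\<close>, states as \<open>(x, y, z)\<close>.\<close>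

definition T_LNB :: "real ^ 4 \<Rightarrow> real ^ 3 \<Rightarrow> real ^ 3" where
  "T_LNB u s =
     (let k = u $ 1; c1 = u $ 2; c2 = u $ 3; c3 = u $ 4; x = s $ 1; y = s $ 2; z = s $ 3
      in vector
        [1/2 * (2 * x + y + z - c1 * (x + y + z)\<^sup>2),
         sqrt ((x + z) / c2) - x - z,
         z + k * z * ((x + y) / (x + y + z)\<^sup>2 - c3)])"

definition E2 :: "real ^ 4 \<Rightarrow> real ^ 3" where
  "E2 u =
     (let c1 = u $ 2; c2 = u $ 3; c3 = u $ 4
      in vector
        [2 * (c2 + c3 - c1) / (c1 + c2 + c3)\<^sup>2,
         2 * (c1 + c3 - c2) / (c1 + c2 + c3)\<^sup>2,
         2 * (c1 + c2 - c3) / (c1 + c2 + c3)\<^sup>2])"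

definition admissible :: "(real ^ 4) set" where
  "admissible = {u. (\<forall>j. u $ j > 0) \<and> (\<forall>i. E2 u $ i > 0)}"

lemma E2_equilibrium:
  assumes "u \<in> admissible"
  shows "T_LNB u (E2 u) = E2 u"
proof -
  define c1 c2 c3 S where defs: "c1 = u $ 2" "c2 = u $ 3" "c3 = u $ 4" "S = c1 + c2 + c3"
  have pos: "c1 > 0" "c2 > 0" "c3 > 0" and S: "S > 0"
    using assms by (auto simp: admissible_def defs forall_4)
  define x y z where xyz: "x = E2 u $ 1" "y = E2 u $ 2" "z = E2 u $ 3"
  have x: "x = 2 * (c2 + c3 - c1) / S\<^sup>2" and y: "y = 2 * (c1 + c3 - c2) / S\<^sup>2"
    and z: "z = 2 * (c1 + c2 - c3) / S\<^sup>2"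
    by (simp_all add: xyz E2_def Let_def defs)
  have "x + y + z = 2 * S / S\<^sup>2"
    unfolding x y z by (simp add: defs(4) add_divide_distrib [symmetric] algebra_simps)
  then have s: "x + y + z = 2 / S"
    using S by (simp add: power2_eq_square)
  have yz: "y + z = 4 * c1 / S\<^sup>2" and xz: "x + z = 4 * c2 / S\<^sup>2" and xy: "x + y = 4 * c3 / S\<^sup>2"
    unfolding x y z by (simp_all add: add_divide_distrib [symmetric])
  have "1/2 * (2 * x + y + z - c1 * (x + y + z)\<^sup>2) = x"
    unfolding s using yz by (simp add: power_divide)
  moreover have "(x + z) / c2 = (2 / S)\<^sup>2"
    using pos by (simp add: xz power_divide)
  then have "sqrt ((x + z) / c2) = 2 / S"
    using S by simp
  then have "sqrt ((x + z) / c2) - x - z = y"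
    using s by simp
  moreover have "(x + y) / (x + y + z)\<^sup>2 = c3"
    unfolding s using xy S by (simp add: power_divide)
  ultimately have "T_LNB u (E2 u) = vector [x, y, z]"
    by (simp only: T_LNB_def Let_def xyz [symmetric] defs(1-3) [symmetric]) simp
  then show ?thesis
    by (simp add: vec_eq_iff forall_3 xyz)
qed

definition a_coeff :: "nat \<Rightarrow> real ^ 4 \<Rightarrow> real" where
  "a_coeff i u = coeff (charpoly (jac T_LNB u (E2 u))) i"

definition flip_surface_E2 :: "(real ^ 4) set" where
  "flip_surface_E2 = {u \<in> admissible. -1 + a_coeff 2 u - a_coeff 1 u + a_coeff 0 u = 0}"

definition PD_LNB :: "real ^ 4 \<Rightarrow> real" where
  "PD_LNB u =
     (let k = u $ 1; c1 = u $ 2; c2 = u $ 3; c3 = u $ 4 in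
       (3 * c1^3 - 11 * c1^2 * c2 - 5 * c1^2 * c3 - 15 * c1 * c2^2 + 54 * c1 * c2 * c3
         - 3 * c1 * c3^2 - c2^3 + 43 * c2^2 * c3 - 47 * c2 * c3^2 + 5 * c3^3) * k
       - 6 * c1^2 + 20 * c1 * c2 - 4 * c1 * c3 - 38 * c2^2 - 36 * c2 * c3 + 2 * c3^2)"

definition PT_LNB_k :: "real ^ 4 \<Rightarrow> real" where
  "PT_LNB_k u =
     (let c1 = u $ 2; c2 = u $ 3; c3 = u $ 4 in
       5 * c3^2 + (2 * c1 - 42 * c2) * c3 - 3 * c1^2 + 14 * c1 * c2 + c2^2)"

definition PT_LNB_c1 :: "real ^ 4 \<Rightarrow> real" where
  "PT_LNB_c1 u =
     (let k = u $ 1; c1 = u $ 2; c2 = u $ 3; c3 = u $ 4 in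
       (k * c3 - c1 * k - c2 * k + 4) * (c3 + c1 - 7 * c2))"

definition PT_LNB_c2 :: "real ^ 4 \<Rightarrow> real" where
  "PT_LNB_c2 u =
     (let k = u $ 1; c1 = u $ 2; c2 = u $ 3; c3 = u $ 4 in
       5 * k * c3^2 + (- 8 * c1 * k - 6 * c2 * k + 2) * c3 + 3 * c1^2 * k + 4 * c1 * c2 * k
       + c2^2 * k - 6 * c1 + 2 * c2)"

definition PT_LNB_c3 :: "real ^ 4 \<Rightarrow> real" where
  "PT_LNB_c3 u =
     (let c1 = u $ 2; c2 = u $ 3; c3 = u $ 4 in
       c3^2 + (- 2 * c1 - 18 * c2) * c3 - 3 * c1^2 + 10 * c1 * c2 - 19 * c2^2)"

end

theory Submission
  imports Defs
begin

text \<open>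
  For a cubic characteristic polynomial \<open>p\<close>, the surface equation reads \<open>p(-1) = 0\<close>. If \<open>-1\<close> is a simple
  eigenvalue, differentiating \<open>p\<^sub>u(\<lambda>\<^sub>1(u)) = 0\<close> shows that \<open>\<lambda>\<^sub>1\<close> has nonzero derivative with respect to
  \<open>u\<^sub>j\<close> only if the partial derivative of \<open>p\<^sub>u(-1)\<close> with respect to \<open>u\<^sub>j\<close> is nonzero. With the state held fixed
  at the equilibrium, \<open>p\<^sub>u(-1)\<close> and its four partial derivatives are \<open>PD\<close> and the \<open>PT\<close> polynomials
  up to explicit factors.
\<close>

section \<open>Characteristic polynomials and eigenvalues of 3 by 3 matrices\<close>

lemma charpoly_3:
  fixes A :: "'a::comm_ring_1 ^ 3 ^ 3"
  shows "charpoly A =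
    [:- det A,
      A $ 1 $ 1 * A $ 2 $ 2 - A $ 1 $ 2 * A $ 2 $ 1 + A $ 1 $ 1 * A $ 3 $ 3 - A $ 1 $ 3 * A $ 3 $ 1
        + A $ 2 $ 2 * A $ 3 $ 3 - A $ 2 $ 3 * A $ 3 $ 2,
      - (A $ 1 $ 1 + A $ 2 $ 2 + A $ 3 $ 3), 1:]"
  unfolding charpoly_def det_3 map_matrix_def mat_def
  by (simp add: algebra_simps)

lemma charpoly_3_nonzero: "charpoly (A :: 'a::comm_ring_1 ^ 3 ^ 3) \<noteq> 0"
  by (simp add: charpoly_3)

lemma poly_charpoly_3:
  fixes A :: "'a::comm_ring_1 ^ 3 ^ 3"
  shows "poly (charpoly A) t =
    t ^ 3 + coeff (charpoly A) 2 * t\<^sup>2 + coeff (charpoly A) 1 * t + coeff (charpoly A) 0"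
  unfolding charpoly_3 by (simp add: algebra_simps power2_eq_square power3_eq_cube numeral_2_eq_2)

lemma poly_map_poly_of_real:
  "poly (map_poly of_real p) (of_real x :: 'a::{real_algebra_1,comm_ring_1}) = of_real (poly p x)"
  by (induction p) (simp_all add: map_poly_pCons)

lemma pderiv_map_poly_of_real:
  "pderiv (map_poly of_real p :: 'a::real_field poly) = map_poly of_real (pderiv p)"
  by (rule poly_eqI) (simp add: coeff_pderiv coeff_map_poly)

text \<open>Passes from the complex spectrum to a real root equation. \<open>proots\<close> lists
  roots only for a nonzero polynomial, hence the appeal to
  \<open>charpoly_3_nonzero\<close>.\<close>

lemma eigvals_real_iff_3:
  fixes A :: "real ^ 3 ^ 3"
  shows "complex_of_real r \<in># eigvals A \<longleftrightarrow> poly (charpoly A) r = 0"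
proof -
  have "map_poly complex_of_real (charpoly A) \<noteq> 0"
    using charpoly_3_nonzero[of A] by (simp add: map_poly_eq_0_iff)
  moreover have "poly (map_poly complex_of_real (charpoly A)) (complex_of_real r)
      = complex_of_real (poly (charpoly A) r)"
    by (simp add: poly_map_poly_of_real)
  ultimately show ?thesis
    by (simp add: eigvals_def)
qed

text \<open>Multiplicity one means that the linear factor at \<open>r\<close> splits off exactly
  once. The derivative at \<open>r\<close> is then the value of the cofactor there, which does not
  vanish.\<close>

lemma simple_eigval_pderiv_nonzero_3:
  fixes A :: "real ^ 3 ^ 3"
  assumes mem: "complex_of_real r \<in># eigvals A"
    and simple: "complex_of_real r \<notin># eigvals A - {#complex_of_real r#}"
  shows "poly (pderiv (charpoly A)) r \<noteq> 0"
proof -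
  define p where "p = map_poly complex_of_real (charpoly A)"
  have p: "p \<noteq> 0"
    using charpoly_3_nonzero[of A] by (simp add: p_def map_poly_eq_0_iff)
  have "count (eigvals A) (complex_of_real r) = 1"
    using mem simple by (simp add: in_diff_count count_eq_zero_iff[symmetric] le_antisym)
  then have "order (complex_of_real r) p = 1"
    using p by (simp add: eigvals_def p_def)
  then obtain q where q: "p = [:- complex_of_real r, 1:] * q"
    "\<not> [:- complex_of_real r, 1:] dvd q"
    using order_decomp[OF p, of "complex_of_real r"] by auto
  have "poly (pderiv p) (complex_of_real r) = poly q (complex_of_real r)"
    unfolding q(1) pderiv_mult by (simp add: pderiv_pCons)
  also have "\<dots> \<noteq> 0"
    using q(2) by (simp add: poly_eq_0_iff_dvd)
  finally have "poly (pderiv p) (complex_of_real r) \<noteq> 0" .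
  moreover have "poly (pderiv p) (complex_of_real r)
      = complex_of_real (poly (pderiv (charpoly A)) r)"
    by (simp add: p_def poly_map_poly_of_real pderiv_map_poly_of_real)
  ultimately show ?thesis by simp
qed

section \<open>Implicit differentiation of the critical eigenvalue\<close>

lemma coeff_charpoly_3_differentiable:
  fixes A :: "real \<Rightarrow> real ^ 3 ^ 3"
  assumes "\<And>a b. (\<lambda>h. A h $ a $ b) differentiable (at t)"
  shows "(\<lambda>h. coeff (charpoly (A h)) i) differentiable (at t)"
proof -
  have pCons: "(\<lambda>h. coeff (pCons (f h) (p h)) i) differentiable (at t)"
    if "f differentiable (at t)" "\<And>i. (\<lambda>h. coeff (p h) i) differentiable (at t)"
    for f :: "real \<Rightarrow> real" and p i
    using that by (cases i) auto
  show ?thesis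
    unfolding charpoly_3 det_3 by (intro pCons) (simp_all add: assms)
qed

text \<open>Differentiating \<open>poly (P h) (l h) = 0\<close> at \<open>h = 0\<close> gives p'(-1)
  l'(0) + \<open>D\<close> = 0, where p = \<open>P 0\<close>. Simplicity of -1 makes p'(-1) nonzero
  and transversality makes l'(0) nonzero, so \<open>D\<close> cannot vanish. The branch
  \<open>l\<close> comes with the transversality condition, so no implicit function theorem is
  invoked.\<close>

lemma flip_bifurcation_deriv_charpoly_nonzero:
  fixes F :: "real ^ 'p \<Rightarrow> real ^ 3 \<Rightarrow> real ^ 3"
  assumes flip: "flip_bifurcation F u x"
    and diff: "\<And>a b. (\<lambda>h. jac F (u + h *\<^sub>R axis j 1) x $ a $ b) differentiable (at 0)"
    and deriv: "((\<lambda>h. poly (charpoly (jac F (u + h *\<^sub>R axis j 1) x)) (- 1))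
      has_real_derivative D) (at 0)"
  shows "D \<noteq> 0"
proof
  assume "D = 0"
  define P where "P h = charpoly (jac F (u + h *\<^sub>R axis j 1) x)" for h
  have "\<exists>d. \<forall>i. ((\<lambda>h. coeff (P h) i) has_real_derivative d i) (at 0)"
    using coeff_charpoly_3_differentiable[OF diff] unfolding P_def
    by (intro choice) (auto simp: real_differentiable_def)
  then obtain d where d: "\<And>i. ((\<lambda>h. coeff (P h) i) has_real_derivative d i) (at 0)"
    by blast
  have "((\<lambda>h. poly (P h) (- 1)) has_real_derivative d 2 - d 1 + d 0) (at 0)"
    unfolding P_def poly_charpoly_3 unfolding P_def[symmetric]
    by (auto intro!: derivative_eq_intros d)
  then have d_eq: "d 2 - d 1 + d 0 = 0"
    using deriv \<open>D = 0\<close> unfolding P_def by (metis DERIV_unique)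

  obtain lam where cont: "isCont lam u" and lam_u: "lam u = - 1"
    and ev: "\<forall>\<^sub>F v in nhds u. complex_of_real (lam v) \<in># eigvals (jac F v x)"
    and D: "\<exists>D. ((\<lambda>h. \<bar>lam (u + h *\<^sub>R axis j 1)\<bar>) has_real_derivative D) (at 0) \<and> D \<noteq> 0"
    using flip unfolding flip_bifurcation_def flip_transversality_def by blast
  define l where "l = (\<lambda>h. lam (u + h *\<^sub>R axis j 1))"
  obtain D' where D': "((\<lambda>h. \<bar>l h\<bar>) has_real_derivative D') (at 0)" "D' \<noteq> 0"
    using D unfolding l_def by blast
  have l0: "l 0 = - 1"
    by (simp add: l_def lam_u)
  have lim: "((\<lambda>h. u + h *\<^sub>R axis j 1) \<longlongrightarrow> u) (nhds 0)"
    by (rule tendsto_eq_intros filterlim_ident refl)+ simp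
  have "(lam \<longlongrightarrow> - 1) (nhds u)"
    using cont lam_u by (simp add: isCont_def tendsto_nhds_iff)
  then have "(l \<longlongrightarrow> - 1) (nhds 0)"
    unfolding l_def by (rule filterlim_compose[OF _ lim])
  \<comment> \<open>Near -1 the absolute value is negation, so the derivative \<open>D'\<close> of
    the modulus yields the derivative \<open>- D'\<close> of the eigenvalue itself.\<close>
  then have "\<forall>\<^sub>F h in nhds 0. l h < 0"
    by (rule order_tendstoD) simp
  then have "\<forall>\<^sub>F h in nhds 0. - \<bar>l h\<bar> = l h"
    by eventually_elim simp
  then have l: "(l has_real_derivative - D') (at 0)"
    using DERIV_minus[OF D'(1)] by (subst (asm) DERIV_cong_ev) auto

  have root: "\<forall>\<^sub>F h in nhds 0. poly (P h) (l h) = 0"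
    using eventually_compose_filterlim[OF ev lim]
    by eventually_elim (simp add: l_def P_def eigvals_real_iff_3)
  \<comment> \<open>This is l'(0) times p'(-1), for the monic cubic p = \<open>P 0\<close>.\<close>
  define E where "E = - D' * (3 - 2 * coeff (P 0) 2 + coeff (P 0) 1)"
  have "((\<lambda>h. poly (P h) (l h)) has_real_derivative E + (d 2 - d 1 + d 0)) (at 0)"
    unfolding P_def poly_charpoly_3 unfolding P_def[symmetric]
    by (rule derivative_eq_intros d l refl)+ (simp add: E_def l0 algebra_simps)
  moreover have "((\<lambda>h. poly (P h) (l h)) has_real_derivative 0) (at 0)"
    using root by (subst DERIV_cong_ev[where g = "\<lambda>_. 0"]) auto
  ultimately have "E = 0"
    using d_eq by (metis DERIV_unique add.right_neutral)
  moreover have "poly (pderiv (charpoly (jac F u x))) (- 1) \<noteq> 0"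
  proof (rule simple_eigval_pderiv_nonzero_3)
    show "complex_of_real (- 1) \<in># eigvals (jac F u x)"
      using flip by (simp add: flip_bifurcation_def flip_eigenvalue_assignment_def)
    have "\<forall>\<mu> \<in># eigvals (jac F u x) - {#-1#}. cmod \<mu> < 1"
      using flip unfolding flip_bifurcation_def flip_eigenvalue_assignment_def by blast
    \<comment> \<open>A second copy of -1 would have modulus 1, against the bound on the remaining
      eigenvalues.\<close>
    then have "- 1 \<notin># eigvals (jac F u x) - {#-1#}"
      by (metis less_irrefl norm_minus_cancel norm_one)
    then show "complex_of_real (- 1) \<notin># eigvals (jac F u x) - {#complex_of_real (- 1)#}"
      by simp
  qed
  then have "3 - 2 * coeff (P 0) 2 + coeff (P 0) 1 \<noteq> 0"
    unfolding P_def charpoly_3 by (simp add: pderiv_pCons numeral_2_eq_2)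
  ultimately show False
    using D'(2) by (simp add: E_def)
qed

section \<open>The Jacobian matrix of the model\<close>

text \<open>The repeated entries reflect the symmetries of the map: its first component involves
  \<open>y\<close> and \<open>z\<close> only through their sum, its second depends on
  \<open>x + z\<close> alone, and its third involves \<open>x\<close> and \<open>y\<close> only
  through \<open>x + y\<close>.\<close>

definition LNB_jac :: "real ^ 4 \<Rightarrow> real ^ 3 \<Rightarrow> real ^ 3 ^ 3" where
  "LNB_jac u s =
     (let k = u $ 1; c1 = u $ 2; c2 = u $ 3; c3 = u $ 4; x = s $ 1; y = s $ 2; z = s $ 3;
          A = c1 * (x + y + z); B = 1 / (2 * sqrt (c2 * (x + z))) - 1;
          C = k * (z * (z - x - y) / (x + y + z) ^ 3)
      in vector
        [vector [1 - A, 1/2 - A, 1/2 - A],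
         vector [B, 0, B],
         vector [C, C, 1 + k * ((x + y) * (x + y - z) / (x + y + z) ^ 3 - c3)]])"

lemma has_derivative_vec_nth: "((\<lambda>t. t $ i) has_derivative (\<lambda>h. h $ i)) (at s)"
  by (rule bounded_linear_imp_has_derivative[OF bounded_linear_vec_nth])

lemma T_LNB_1_has_derivative:
  "((\<lambda>t. 1/2 * (2 * t $ 1 + t $ 2 + t $ 3 - c * (t $ 1 + t $ 2 + t $ 3)\<^sup>2)) has_derivative
  (\<lambda>h. (1 - c * (s $ 1 + s $ 2 + s $ 3)) * h $ 1 + (1/2 - c * (s $ 1 + s $ 2 + s $ 3)) * h $ 2
  + (1/2 - c * (s $ 1 + s $ 2 + s $ 3)) * h $ 3)) (at (s::real^3))"
  by (rule derivative_eq_intros has_derivative_vec_nth refl)+ (simp add: fun_eq_iff field_simps)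

lemma T_LNB_2_has_derivative:
  assumes "c > 0" "s $ 1 + s $ 3 > 0"
  shows "((\<lambda>t. sqrt ((t $ 1 + t $ 3) / c) - t $ 1 - t $ 3) has_derivative
  (\<lambda>h. (1 / (2 * sqrt (c * (s $ 1 + s $ 3))) - 1) * h $ 1
  + (1 / (2 * sqrt (c * (s $ 1 + s $ 3))) - 1) * h $ 3)) (at (s::real^3))"
proof -
  have pos: "(s $ 1 + s $ 3) / c > 0" "c \<noteq> 0" using assms by simp_all
  \<comment> \<open>The chain rule produces \<open>c\<close> times the root of a quotient; for
    \<open>c > 0\<close> this is the root of the product that occurs in the claim.\<close>
  have "(s $ 1 + s $ 3) / c * c\<^sup>2 = c * (s $ 1 + s $ 3)"
    using assms by (simp add: power2_eq_square)
  then have sq: "sqrt (c * (s $ 1 + s $ 3)) = sqrt ((s $ 1 + s $ 3) / c) * c"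
    using assms by (metis abs_of_pos real_sqrt_abs real_sqrt_mult)
  have sq0: "sqrt ((s $ 1 + s $ 3) / c) > 0" using pos by simp
  show ?thesis
    unfolding sq using pos(1)
    apply -
    apply (rule derivative_eq_intros has_derivative_vec_nth refl pos | assumption)+
    using sq0 pos(2) apply (simp add: fun_eq_iff del: real_sqrt_gt_0_iff)
    apply (simp add: divide_simps del: real_sqrt_gt_0_iff)
    apply (simp add: algebra_simps)
    done
qed

lemma T_LNB_3_has_derivative:
  assumes "s $ 1 + s $ 2 + s $ 3 > 0"
  shows "((\<lambda>t. t $ 3 + k * t $ 3 * ((t $ 1 + t $ 2) / (t $ 1 + t $ 2 + t $ 3)\<^sup>2 - c)) has_derivative
  (\<lambda>h. k * (s $ 3 * (s $ 3 - s $ 1 - s $ 2) / (s $ 1 + s $ 2 + s $ 3) ^ 3) * h $ 1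
   + k * (s $ 3 * (s $ 3 - s $ 1 - s $ 2) / (s $ 1 + s $ 2 + s $ 3) ^ 3) * h $ 2
   + (1 + k * ((s $ 1 + s $ 2) * (s $ 1 + s $ 2 - s $ 3) / (s $ 1 + s $ 2 + s $ 3) ^ 3 - c)) * h $ 3)) (at (s::real^3))"
proof -
  define S where "S = s $ 1 + s $ 2 + s $ 3"
  have S: "S \<noteq> 0" "s $ 1 + s $ 2 + s $ 3 \<noteq> 0" "(s $ 1 + s $ 2 + s $ 3)\<^sup>2 \<noteq> 0" using assms by (auto simp: S_def)
  \<comment> \<open>Eliminating \<open>s $ 1\<close> leaves powers of the single variable
    \<open>S\<close> as denominators.\<close>
  have s: "s $ 1 = S - s $ 2 - s $ 3" by (simp add: S_def)
  show ?thesis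
    apply (rule derivative_eq_intros has_derivative_vec_nth refl S)+
    apply (simp only: fun_eq_iff S_def[symmetric])
    apply (rule allI)
    using S(1) unfolding s
    apply (simp add: divide_simps power2_eq_square power3_eq_cube)
    apply (simp add: algebra_simps)
    done
qed

lemma jac_T_LNB:
  assumes c2: "u $ 3 > 0" and xz: "s $ 1 + s $ 3 > 0" and S: "s $ 1 + s $ 2 + s $ 3 > 0"
  shows "jac T_LNB u s = LNB_jac u s"
proof -
  have "((\<lambda>t. T_LNB u t $ i) has_derivative (\<lambda>h. (LNB_jac u s *v h) $ i)) (at s)" for i
  proof -
    consider "i = 1" | "i = 2" | "i = 3" using exhaust_3 by blast
    then show ?thesis
      using T_LNB_1_has_derivative[of "u $ 2" s] T_LNB_2_has_derivative[OF c2 xz]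
        T_LNB_3_has_derivative[OF S, of "u $ 1" "u $ 4"]
      by cases (simp_all add: T_LNB_def LNB_jac_def Let_def matrix_vector_mult_def sum_3)
  qed
  then have "(T_LNB u has_derivative (*v) (LNB_jac u s)) (at s)"
    by (subst has_derivative_componentwise_within) (auto simp: Basis_vec_def inner_axis)
  then show ?thesis
    unfolding jac_def jacobian_def
    by (metis frechet_derivative_at matrix_of_matrix_vector_mul)
qed

section \<open>The Jacobian at the equilibrium and its characteristic polynomial at -1\<close>

text \<open>The parameters \<open>v\<close> vary independently of the state \<open>E2 u\<close>, as
  transversality requires. With \<sigma> = \<open>a + b + c\<close>, the state satisfies x + y + z =
  2/\<sigma>, x + z = 4b/\<sigma>^2 and x + y = 4c/\<sigma>^2, which collapses the entries.\<close>

lemma LNB_jac_E2: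
  fixes u v :: "real ^ 4"
  defines "a \<equiv> u $ 2" and "b \<equiv> u $ 3" and "c \<equiv> u $ 4"
  assumes pos: "a + b + c > 0"
  shows "LNB_jac v (E2 u) =
    (let A = 2 * v $ 2 / (a + b + c); B = (a + b + c) / (4 * sqrt (v $ 3 * b)) - 1;
         C = v $ 1 * ((a + b - c) * (a + b - 3 * c) / (2 * (a + b + c)))
     in vector
        [vector [1 - A, 1/2 - A, 1/2 - A],
         vector [B, 0, B],
         vector [C, C, 1 + v $ 1 * (c * (3 * c - a - b) / (a + b + c) - v $ 4)]])"
proof -
  define \<sigma> where "\<sigma> = a + b + c"
  define x y z where xyz: "x = E2 u $ 1" "y = E2 u $ 2" "z = E2 u $ 3"
  have \<sigma>: "\<sigma> > 0" using pos by (simp add: \<sigma>_def)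
  have x: "x = 2 * (b + c - a) / \<sigma>\<^sup>2" and y: "y = 2 * (a + c - b) / \<sigma>\<^sup>2"
    and z: "z = 2 * (a + b - c) / \<sigma>\<^sup>2"
    by (simp_all add: xyz E2_def Let_def \<sigma>_def a_def b_def c_def)
  have "x + y + z = 2 * \<sigma> / \<sigma>\<^sup>2"
    unfolding x y z by (simp add: \<sigma>_def add_divide_distrib [symmetric] algebra_simps)
  then have s: "x + y + z = 2 / \<sigma>"
    using \<sigma> by (simp add: power2_eq_square)
  have xz: "x + z = 4 * b / \<sigma>\<^sup>2" and xy: "x + y = 4 * c / \<sigma>\<^sup>2"
    unfolding x y z by (simp_all add: add_divide_distrib [symmetric])
  have zxy: "z - x - y = 2 * (a + b - 3 * c) / \<sigma>\<^sup>2"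
    unfolding x y z by (simp add: add_divide_distrib [symmetric] diff_divide_distrib [symmetric])
  have xyz': "x + y - z = 2 * (3 * c - a - b) / \<sigma>\<^sup>2"
    unfolding x y z by (simp add: add_divide_distrib [symmetric] diff_divide_distrib [symmetric])
  have "v $ 3 * (x + z) = (2 / \<sigma>)\<^sup>2 * (v $ 3 * b)"
    by (simp add: xz power_divide)
  then have "sqrt (v $ 3 * (x + z)) = 2 / \<sigma> * sqrt (v $ 3 * b)"
    using \<sigma> by (simp only: real_sqrt_mult real_sqrt_abs) simp
  then have B: "1 / (2 * sqrt (v $ 3 * (x + z))) - 1 = \<sigma> / (4 * sqrt (v $ 3 * b)) - 1"
    by simp
  have C: "z * (z - x - y) / (x + y + z) ^ 3 = (a + b - c) * (a + b - 3 * c) / (2 * \<sigma>)"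
    unfolding s zxy unfolding z using \<sigma> by (simp add: field_simps power2_eq_square power3_eq_cube)
  have E: "(x + y) * (x + y - z) / (x + y + z) ^ 3 = c * (3 * c - a - b) / \<sigma>"
    unfolding s xyz' unfolding xy using \<sigma> by (simp add: field_simps power2_eq_square power3_eq_cube)
  show ?thesis
    unfolding LNB_jac_def Let_def xyz[symmetric] B C E unfolding s \<sigma>_def[symmetric]
    by (simp add: mult.commute)
qed

text \<open>Two parameter vectors: \<open>u\<close> fixes the state \<open>E2 u\<close>, and \<open>v\<close> is the one to be differentiated.\<close>

definition LNB_flip_poly :: "real ^ 4 \<Rightarrow> real ^ 4 \<Rightarrow> real" where
  "LNB_flip_poly u v =
    (let a = u $ 2; b = u $ 3; c = u $ 4;
         A = 2 * v $ 2 / (a + b + c); B = (a + b + c) / (4 * sqrt (v $ 3 * b)) - 1;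
         C = v $ 1 * ((a + b - c) * (a + b - 3 * c) / (2 * (a + b + c)));
         E = 2 + v $ 1 * (c * (3 * c - a - b) / (a + b + c) - v $ 4)
     in (1/2 - A) * (B * E - 2 * B * C + C) - (2 - A) * (E - B * C))"

text \<open>The value at -1 is -det(I + J), where J is the Jacobian matrix.
  \<open>LNB_flip_poly\<close> is its expansion, with \<open>E\<close> the last diagonal entry of I
  + J.\<close>

lemma poly_charpoly_LNB_jac_E2:
  assumes "u $ 2 + u $ 3 + u $ 4 > 0"
  shows "poly (charpoly (LNB_jac v (E2 u))) (- 1) = LNB_flip_poly u v"
  unfolding LNB_jac_E2[OF assms] charpoly_3 det_3 LNB_flip_poly_def Let_def
  by simp algebra

text \<open>For \<open>v = u\<close> the root of \<open>v $ 3 * b\<close> is \<open>b\<close>, and a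
  rational identity remains.\<close>

lemma LNB_flip_poly_diagonal:
  assumes "u $ 3 > 0" "u $ 2 + u $ 3 + u $ 4 > 0"
  shows "LNB_flip_poly u u = PD_LNB u / (8 * u $ 3 * (u $ 2 + u $ 3 + u $ 4))"
proof -
  define k a b c \<sigma> where defs: "k = u $ 1" "a = u $ 2" "b = u $ 3" "c = u $ 4" "\<sigma> = a + b + c"
  have nz: "b > 0" "\<sigma> > 0" using assms by (simp_all add: defs)
  \<comment> \<open>With \<open>a\<close> eliminated, only \<open>b\<close> and \<sigma> occur in
    denominators, so clearing them leaves a polynomial identity.\<close>
  have a: "a = \<sigma> - b - c" by (simp add: defs(5))
  show ?thesis
    unfolding LNB_flip_poly_def PD_LNB_def Let_def defs(1-4)[symmetric] defs(5)[symmetric]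
    using nz unfolding a by (simp add: divide_simps) algebra
qed

text \<open>All four partial derivatives are treated at once: \<open>d\<close> is the indicator of
  the direction \<open>j\<close>, so one summand survives. The ingredients separate the parameters:
  \<open>A\<close> varies with c1, \<open>B\<close> with c2, \<open>C\<close> with k, and
  \<open>E\<close> with k and c3.\<close>

lemma has_real_derivative_LNB_flip_poly:
  fixes u :: "real ^ 4" and j :: 4
  defines "a \<equiv> u $ 2" and "b \<equiv> u $ 3" and "c \<equiv> u $ 4" and "d \<equiv> (\<lambda>i. axis j 1 $ i) :: 4 \<Rightarrow> real"
  assumes pos: "b > 0" "a + b + c > 0"
  shows "((\<lambda>h. LNB_flip_poly u (u + h *\<^sub>R axis j 1)) has_real_derivative
    - ((a + b - c) / (8 * b * (a + b + c)) * PT_LNB_k u * d 1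
      + PT_LNB_c1 u / (4 * b * (a + b + c)) * d 2
      + PT_LNB_c2 u / (16 * b\<^sup>2) * d 3
      + u $ 1 / (8 * b * (a + b + c)) * PT_LNB_c3 u * d 4)) (at 0)"
proof -
  define k \<sigma> where defs: "k = u $ 1" "\<sigma> = a + b + c"
  have nz: "b > 0" "\<sigma> > 0" "b \<noteq> 0" "\<sigma> \<noteq> 0" using pos by (simp_all add: defs)
  have a: "a = \<sigma> - b - c" by (simp add: defs)
  have nth: "(u + h *\<^sub>R axis j 1) $ i = u $ i + h * d i" for h i
    by (simp add: d_def)
  define g e A B C E where g: "g = (a + b - c) * (a + b - 3 * c) / (2 * \<sigma>)"
    and e: "e = c * (3 * c - a - b) / \<sigma>"
    and A: "A = 2 * a / \<sigma>" and B: "B = \<sigma> / (4 * b) - 1"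
    and C: "C = k * g" and E: "E = 2 + k * (e - c)"
  have dA: "((\<lambda>h. 2 * (a + h * d 2) / \<sigma>) has_real_derivative 2 / \<sigma> * d 2) (at 0)"
    by (rule derivative_eq_intros refl nz)+ (simp add: nz)
  have dB: "((\<lambda>h. \<sigma> / (4 * sqrt ((b + h * d 3) * b)) - 1) has_real_derivative
      - \<sigma> / (8 * b\<^sup>2) * d 3) (at 0)"
    apply (rule derivative_eq_intros refl | (use nz in simp; fail))+
    using nz by (simp add: divide_simps power2_eq_square)
  have dC: "((\<lambda>h. (k + h * d 1) * g) has_real_derivative g * d 1) (at 0)"
    by (rule derivative_eq_intros refl)+ simp
  have dE: "((\<lambda>h. 2 + (k + h * d 1) * (e - (c + h * d 4))) has_real_derivative
      (e - c) * d 1 - k * d 4) (at 0)"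
    by (rule derivative_eq_intros refl)+ (simp add: algebra_simps)
  \<comment> \<open>The next four identities factor the partial derivatives with respect to k, c1,
    c2 and c3.\<close>
  have pk: "(1/2 - A) * (B * (e - c) - 2 * B * g + g) - (2 - A) * ((e - c) - B * g)
      = - ((a + b - c) / (8 * b * \<sigma>) * PT_LNB_k u)"
    unfolding A B g e PT_LNB_k_def Let_def a_def[symmetric] b_def[symmetric] c_def[symmetric]
    using nz unfolding a by (simp add: divide_simps) algebra
  have p1: "- (2 / \<sigma>) * (B * E - 2 * B * C + C) + 2 / \<sigma> * (E - B * C)
      = - PT_LNB_c1 u / (4 * b * \<sigma>)"
    unfolding A B E C g e PT_LNB_c1_def Let_def defs(1)[symmetric]
      a_def[symmetric] b_def[symmetric] c_def[symmetric]
    using nz unfolding a by (simp add: divide_simps) algebra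
  have p2: "- \<sigma> / (8 * b\<^sup>2) * ((1/2 - A) * (E - 2 * C) + (2 - A) * C)
      = - PT_LNB_c2 u / (16 * b\<^sup>2)"
    unfolding A E C g e PT_LNB_c2_def Let_def defs(1)[symmetric]
      a_def[symmetric] b_def[symmetric] c_def[symmetric]
    using nz unfolding a by (simp add: divide_simps) algebra
  have p3: "- ((1/2 - A) * B * k) + (2 - A) * k = - k / (8 * b * \<sigma>) * PT_LNB_c3 u"
    unfolding A B PT_LNB_c3_def Let_def
      a_def[symmetric] b_def[symmetric] c_def[symmetric]
    using nz unfolding a by (simp add: divide_simps) algebra
  \<comment> \<open>Abstract functions keep the explicit quotients and roots out of the product rule
    computation.\<close>
  have product_rule: "((\<lambda>h. (1/2 - fA h) * (fB h * fE h - 2 * fB h * fC h + fC h)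
        - (2 - fA h) * (fE h - fB h * fC h)) has_real_derivative
      ((1/2 - A) * (B * e' - 2 * B * g + g) - (2 - A) * (e' - B * g)) * d 1
      + (- r * (B * E - 2 * B * C + C) + r * (E - B * C)) * d 2
      + (q * ((1/2 - A) * (E - 2 * C) + (2 - A) * C)) * d 3
      + (- ((1/2 - A) * B * k) + (2 - A) * k) * d 4) (at 0)"
    if "(fA has_real_derivative r * d 2) (at 0)" "(fB has_real_derivative q * d 3) (at 0)"
      "(fC has_real_derivative g * d 1) (at 0)" "(fE has_real_derivative e' * d 1 - k * d 4) (at 0)"
      "fA 0 = A" "fB 0 = B" "fC 0 = C" "fE 0 = E"
    for fA fB fC fE :: "real \<Rightarrow> real" and r q e'
    by (rule that(1-4) derivative_eq_intros refl)+ (simp add: that(5-8) algebra_simps)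
  have "((\<lambda>h. LNB_flip_poly u (u + h *\<^sub>R axis j 1)) has_real_derivative
      ((1/2 - A) * (B * (e - c) - 2 * B * g + g) - (2 - A) * ((e - c) - B * g)) * d 1
      + (- (2 / \<sigma>) * (B * E - 2 * B * C + C) + 2 / \<sigma> * (E - B * C)) * d 2
      + (- \<sigma> / (8 * b\<^sup>2) * ((1/2 - A) * (E - 2 * C) + (2 - A) * C)) * d 3
      + (- ((1/2 - A) * B * k) + (2 - A) * k) * d 4) (at 0)"
    unfolding LNB_flip_poly_def Let_def nth a_def[symmetric] b_def[symmetric] c_def[symmetric]
      defs[symmetric] g[symmetric] e[symmetric]
    by (rule product_rule[OF dA dB dC dE]) (use nz in \<open>simp_all add: A B C E\<close>)
  then show ?thesis
    unfolding pk p1 p2 p3 by (simp add: defs)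
qed

text \<open>The only non-polynomial dependence on \<open>h\<close> is the root in the second row,
  whose radicand equals \<open>(u $ 3)\<^sup>2 > 0\<close> at \<open>h = 0\<close>.\<close>

lemma LNB_jac_E2_entry_differentiable:
  fixes u :: "real ^ 4"
  assumes "u $ 3 > 0" "u $ 2 + u $ 3 + u $ 4 > 0"
  shows "(\<lambda>h. LNB_jac (u + h *\<^sub>R axis j 1) (E2 u) $ m $ n) differentiable (at 0)"
proof -
  have nth: "(\<lambda>h. u $ i + h * axis j 1 $ i) differentiable (at (0 :: real))" for i
    by simp
  have "((\<lambda>h. sqrt ((u $ 3 + h * axis j 1 $ 3) * u $ 3)) has_real_derivative
      axis j 1 $ 3 * u $ 3 * (inverse (sqrt (u $ 3 * u $ 3)) / 2)) (at 0)"
    using assms(1) by (auto intro!: derivative_eq_intros)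
  then have sqrt: "(\<lambda>h. sqrt ((u $ 3 + h * axis j 1 $ 3) * u $ 3)) differentiable (at 0)"
    by (auto simp: real_differentiable_def)
  have B: "(\<lambda>h. (u $ 2 + u $ 3 + u $ 4) / (4 * sqrt ((u $ 3 + h * axis j 1 $ 3) * u $ 3)) - 1)
      differentiable (at 0)"
    by (intro differentiable_diff differentiable_divide differentiable_mult sqrt differentiable_const)
      (use assms(1) in simp)
  have "m = 1 \<or> m = 2 \<or> m = 3" "n = 1 \<or> n = 2 \<or> n = 3"
    using exhaust_3 by blast+
  then show ?thesis
    unfolding LNB_jac_E2[OF assms(2)] Let_def vector_add_component vector_scaleR_component
      real_scaleR_def
    by (elim disjE; simp only: vector_3)
      (intro B differentiable_diff differentiable_add differentiable_mult differentiable_divide nth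
        differentiable_const; use assms in simp)+
qed

section \<open>Surface equation and transversality for the model\<close>

lemma admissible_positive:
  assumes "u \<in> admissible"
  shows "u $ 3 > 0" "u $ 2 + u $ 3 + u $ 4 > 0" "E2 u $ 1 + E2 u $ 3 > 0"
    "E2 u $ 1 + E2 u $ 2 + E2 u $ 3 > 0"
  using assms by (auto simp: admissible_def forall_4 forall_3 add_pos_pos)

lemma flip_bifurcation_LNB_directional_derivative_nonzero:
  fixes u :: "real ^ 4" and j :: 4
  assumes u: "u \<in> admissible" and flip: "flip_bifurcation T_LNB u (E2 u)"
  defines "a \<equiv> u $ 2" and "b \<equiv> u $ 3" and "c \<equiv> u $ 4" and "d \<equiv> (\<lambda>i. axis j 1 $ i) :: 4 \<Rightarrow> real"
  shows "- ((a + b - c) / (8 * b * (a + b + c)) * PT_LNB_k u * d 1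
      + PT_LNB_c1 u / (4 * b * (a + b + c)) * d 2
      + PT_LNB_c2 u / (16 * b\<^sup>2) * d 3
      + u $ 1 / (8 * b * (a + b + c)) * PT_LNB_c3 u * d 4) \<noteq> 0" (is "?D \<noteq> 0")
proof -
  note pos = admissible_positive[OF u]
  \<comment> \<open>The state is frozen, so among the conditions of \<open>jac_T_LNB\<close> only
    positivity of c2 depends on \<open>h\<close>, and it persists for small \<open>h\<close>.
    Agreement near 0 then transfers the derivatives from \<open>LNB_jac\<close> to
    \<open>jac\<close>.\<close>
  have "((\<lambda>h. (u + h *\<^sub>R axis j 1) $ 3) \<longlongrightarrow> (u + 0 *\<^sub>R axis j 1) $ 3) (nhds 0)"
    by (intro tendsto_intros filterlim_ident)
  then have "\<forall>\<^sub>F h in nhds 0. (u + h *\<^sub>R axis j 1) $ 3 > 0"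
    by (rule order_tendstoD) (use pos in simp)
  then have ev: "\<forall>\<^sub>F h in nhds 0.
      jac T_LNB (u + h *\<^sub>R axis j 1) (E2 u) = LNB_jac (u + h *\<^sub>R axis j 1) (E2 u)"
    by eventually_elim (use jac_T_LNB pos in blast)
  show ?thesis
  proof (rule flip_bifurcation_deriv_charpoly_nonzero[OF flip])
    fix m n
    obtain D where "((\<lambda>h. LNB_jac (u + h *\<^sub>R axis j 1) (E2 u) $ m $ n) has_real_derivative D) (at 0)"
      using LNB_jac_E2_entry_differentiable[OF pos(1,2), of j m n] by (auto simp: real_differentiable_def)
    moreover have "\<forall>\<^sub>F h in nhds 0. jac T_LNB (u + h *\<^sub>R axis j 1) (E2 u) $ m $ n
        = LNB_jac (u + h *\<^sub>R axis j 1) (E2 u) $ m $ n"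
      using ev by eventually_elim simp
    ultimately show "(\<lambda>h. jac T_LNB (u + h *\<^sub>R axis j 1) (E2 u) $ m $ n) differentiable (at 0)"
      unfolding real_differentiable_def by (subst DERIV_cong_ev[OF refl _ refl]) auto
  next
    have "\<forall>\<^sub>F h in nhds 0. poly (charpoly (jac T_LNB (u + h *\<^sub>R axis j 1) (E2 u))) (- 1)
        = LNB_flip_poly u (u + h *\<^sub>R axis j 1)"
      using ev by eventually_elim (simp add: poly_charpoly_LNB_jac_E2[OF pos(2)])
    then show "((\<lambda>h. poly (charpoly (jac T_LNB (u + h *\<^sub>R axis j 1) (E2 u))) (- 1))
        has_real_derivative ?D) (at 0)"
      using has_real_derivative_LNB_flip_poly[OF pos(1,2), of j]
      unfolding a_def b_def c_def d_def
      by (subst DERIV_cong_ev[OF refl _ refl])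
  qed
qed

theorem theorem5:
  shows "flip_surface_E2 = {u \<in> admissible. PD_LNB u = 0} \<and>
         (\<forall>u \<in> admissible. flip_bifurcation T_LNB u (E2 u) \<longrightarrow>
            PT_LNB_k u \<noteq> 0 \<and> PT_LNB_c1 u \<noteq> 0 \<and> PT_LNB_c2 u \<noteq> 0 \<and> PT_LNB_c3 u \<noteq> 0)"
proof (intro conjI ballI impI)
  have "-1 + a_coeff 2 u - a_coeff 1 u + a_coeff 0 u = 0 \<longleftrightarrow> PD_LNB u = 0"
    if u: "u \<in> admissible" for u
  proof -
    note pos = admissible_positive[OF u]
    \<comment> \<open>The surface expression is the monic cubic at -1; it equals
      \<open>PD_LNB u\<close> over a positive denominator.\<close>
    have "-1 + a_coeff 2 u - a_coeff 1 u + a_coeff 0 u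
        = poly (charpoly (jac T_LNB u (E2 u))) (- 1)"
      by (simp add: a_coeff_def poly_charpoly_3)
    also have "\<dots> = PD_LNB u / (8 * u $ 3 * (u $ 2 + u $ 3 + u $ 4))"
      using pos by (simp add: jac_T_LNB poly_charpoly_LNB_jac_E2 LNB_flip_poly_diagonal)
    finally show ?thesis
      using pos by simp
  qed
  then show "flip_surface_E2 = {u \<in> admissible. PD_LNB u = 0}"
    by (auto simp: flip_surface_E2_def)
next
  fix u
  assume flip: "u \<in> admissible" "flip_bifurcation T_LNB u (E2 u)"
  show "PT_LNB_k u \<noteq> 0" "PT_LNB_c1 u \<noteq> 0" "PT_LNB_c2 u \<noteq> 0" "PT_LNB_c3 u \<noteq> 0"
    \<comment> \<open>Each direction leaves one product containing its \<open>PT\<close> polynomial,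
      and factors of a nonzero product are nonzero.\<close>
    using flip_bifurcation_LNB_directional_derivative_nonzero[OF flip, of 1] flip_bifurcation_LNB_directional_derivative_nonzero[OF flip, of 2]
      flip_bifurcation_LNB_directional_derivative_nonzero[OF flip, of 3] flip_bifurcation_LNB_directional_derivative_nonzero[OF flip, of 4]
    by (auto simp: axis_def)
qed

end
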